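(* For each integer $d\geq 2$, there are infinitely many pairwise combinatorially inequivalent $d$-dimensional polytopes that are resistance positive.
   Context: Polytopes are convex polytopes, considered up to combinatorial equivalence. For a finite graph $G=(V,E)$ with adjacency matrix $\mathbf{A}$ and diagonal degree matrix $\mathbf{D}$, let $\mathbf{L}=\mathbf{D}-\mathbf{A}$ be its Laplacian and $\mathbf{L}^\dagger$ its Moore--Penrose pseudoinverse. The effective resistance between $u,v\in V$ is $r_{uv}=(\mathbf{1}_u-\mathbf{1}_v)^\top\mathbf{L}^\dagger(\mathbf{1}_u-\mathbf{1}_v)$, where $\mathbf{1}_u$ is the indicator vector of $u$. The resistance curvature at $v$ is $\kappa(v)=1-\frac12\sum_{u\sim v} r_{uv}$, the sum over neighbors $u$ of $v$. A polytope is resistance positive if $\kappa(v)>0$ for every vertex $v$ of its graph (1-skeleton). *)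

theory Defs
  imports "HOL-Analysis.Analysis"
begin

(* A real matrix whose rows and columns are indexed by a finite set V is a function of two
   arguments of which only the values on V \<times> V are relevant. *)
type_synonym 'v mat_on = "'v \<Rightarrow> 'v \<Rightarrow> real"

definition mat_mult_on :: "'v set \<Rightarrow> 'v mat_on \<Rightarrow> 'v mat_on \<Rightarrow> 'v mat_on" where
  "mat_mult_on V M N = (\<lambda>i j. \<Sum>k\<in>V. M i k * N k j)"

(* The four Penrose conditions for real matrices. *)
definition is_pseudoinverse_on :: "'v set \<Rightarrow> 'v mat_on \<Rightarrow> 'v mat_on \<Rightarrow> bool" where
  "is_pseudoinverse_on V M X \<longleftrightarrow>
     (\<forall>i\<in>V. \<forall>j\<in>V. mat_mult_on V (mat_mult_on V M X) M i j = M i j) \<and>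
     (\<forall>i\<in>V. \<forall>j\<in>V. mat_mult_on V (mat_mult_on V X M) X i j = X i j) \<and>
     (\<forall>i\<in>V. \<forall>j\<in>V. mat_mult_on V M X i j = mat_mult_on V M X j i) \<and>
     (\<forall>i\<in>V. \<forall>j\<in>V. mat_mult_on V X M i j = mat_mult_on V X M j i)"

lemma mat_mult_on_assoc:
  "mat_mult_on V (mat_mult_on V A B) C = mat_mult_on V A (mat_mult_on V B C)"
  unfolding mat_mult_on_def
  by (intro ext, simp add: sum_distrib_left sum_distrib_right mult.assoc, rule sum.swap)

lemma mat_mult_on_cong:
  assumes "\<And>i j. i \<in> V \<Longrightarrow> j \<in> V \<Longrightarrow> A i j = A' i j"
    and "\<And>i j. i \<in> V \<Longrightarrow> j \<in> V \<Longrightarrow> B i j = B' i j"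
    and "i \<in> V" "j \<in> V"
  shows "mat_mult_on V A B i j = mat_mult_on V A' B' i j"
  unfolding mat_mult_on_def using assms by (intro sum.cong) auto

lemma mat_mult_on_transpose:
  "mat_mult_on V (\<lambda>i j. A j i) (\<lambda>i j. B j i) i j = mat_mult_on V B A j i"
  unfolding mat_mult_on_def by (simp add: mult.commute)

lemma is_pseudoinverse_on_unique:
  assumes X: "is_pseudoinverse_on V M X" and Y: "is_pseudoinverse_on V M Y"
    and ij: "i \<in> V" "j \<in> V"
  shows "X i j = Y i j"
proof -
  let ?m = "mat_mult_on V"
  note D = is_pseudoinverse_on_def
  have MXY: "?m M X i j = ?m M Y i j" if "i \<in> V" "j \<in> V" for i j
  proof -
    have "?m M X i j = ?m (?m (?m M Y) M) X i j"
      using Y that by (intro mat_mult_on_cong) (auto simp: D)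
    also have "\<dots> = ?m (?m M Y) (?m M X) i j"
      by (simp add: mat_mult_on_assoc)
    also have "\<dots> = ?m (\<lambda>i j. ?m M Y j i) (\<lambda>i j. ?m M X j i) i j"
      using X Y that by (intro mat_mult_on_cong) (auto simp: D)
    also have "\<dots> = ?m (?m M X) (?m M Y) j i"
      by (rule mat_mult_on_transpose)
    also have "\<dots> = ?m (?m (?m M X) M) Y j i"
      by (simp add: mat_mult_on_assoc)
    also have "\<dots> = ?m M Y j i"
      using X that by (intro mat_mult_on_cong) (auto simp: D)
    also have "\<dots> = ?m M Y i j"
      using Y that by (auto simp: D)
    finally show ?thesis .
  qed
  have XYM: "?m X M i j = ?m Y M i j" if "i \<in> V" "j \<in> V" for i j
  proof -
    have "?m X M i j = ?m X (?m (?m M Y) M) i j"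
      using Y that by (intro mat_mult_on_cong) (auto simp: D)
    also have "\<dots> = ?m (?m X M) (?m Y M) i j"
      by (simp add: mat_mult_on_assoc)
    also have "\<dots> = ?m (\<lambda>i j. ?m X M j i) (\<lambda>i j. ?m Y M j i) i j"
      using X Y that by (intro mat_mult_on_cong) (auto simp: D)
    also have "\<dots> = ?m (?m Y M) (?m X M) j i"
      by (rule mat_mult_on_transpose)
    also have "\<dots> = ?m Y (?m (?m M X) M) j i"
      by (simp add: mat_mult_on_assoc)
    also have "\<dots> = ?m Y M j i"
      using X that by (intro mat_mult_on_cong) (auto simp: D)
    also have "\<dots> = ?m Y M i j"
      using Y that by (auto simp: D)
    finally show ?thesis .
  qed
  have "X i j = ?m X (?m M X) i j"
    using X ij by (simp add: D flip: mat_mult_on_assoc)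
  also have "\<dots> = ?m X (?m M Y) i j"
    by (rule mat_mult_on_cong[OF refl MXY ij])
  also have "\<dots> = ?m (?m X M) Y i j"
    by (simp add: mat_mult_on_assoc)
  also have "\<dots> = ?m (?m Y M) Y i j"
    by (rule mat_mult_on_cong[OF XYM refl ij])
  also have "\<dots> = Y i j"
    using Y ij by (simp add: D)
  finally show ?thesis .
qed

(* The Moore-Penrose pseudoinverse. The zero entries outside V \<times> V only serve to make it
   unique as a function. *)
definition pseudoinverse_on :: "'v set \<Rightarrow> 'v mat_on \<Rightarrow> 'v mat_on" where
  "pseudoinverse_on V M =
     (THE X. is_pseudoinverse_on V M X \<and> (\<forall>i j. i \<notin> V \<or> j \<notin> V \<longrightarrow> X i j = 0))"

lemma pseudoinverse_on_eqI:
  assumes X: "is_pseudoinverse_on V M X" and 0: "\<And>i j. i \<notin> V \<or> j \<notin> V \<Longrightarrow> X i j = 0"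
  shows "pseudoinverse_on V M = X"
  unfolding pseudoinverse_on_def
proof (rule the_equality)
  fix Y assume Y: "is_pseudoinverse_on V M Y \<and> (\<forall>i j. i \<notin> V \<or> j \<notin> V \<longrightarrow> Y i j = 0)"
  show "Y = X"
  proof (intro ext)
    fix i j show "Y i j = X i j"
      using is_pseudoinverse_on_unique[of V M Y X i j] X Y 0 by metis
  qed
qed (use assms in auto)

(* A graph is given by a finite vertex set V and a set E of edges {u, v} with u, v distinct
   elements of V. *)

definition neighbours :: "'v set \<Rightarrow> 'v set set \<Rightarrow> 'v \<Rightarrow> 'v set" where
  "neighbours V E v = {u \<in> V. {u, v} \<in> E}"

definition adjacency_matrix :: "'v set set \<Rightarrow> 'v mat_on" where
  "adjacency_matrix E u v = (if {u, v} \<in> E then 1 else 0)"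

definition degree_matrix :: "'v set \<Rightarrow> 'v set set \<Rightarrow> 'v mat_on" where
  "degree_matrix V E u v = (if u = v then real (card (neighbours V E u)) else 0)"

definition laplacian :: "'v set \<Rightarrow> 'v set set \<Rightarrow> 'v mat_on" where
  "laplacian V E u v = degree_matrix V E u v - adjacency_matrix E u v"

definition effective_resistance :: "'v set \<Rightarrow> 'v set set \<Rightarrow> 'v \<Rightarrow> 'v \<Rightarrow> real" where
  "effective_resistance V E u v =
     (\<Sum>i\<in>V. \<Sum>j\<in>V. (indicat_real {u} i - indicat_real {v} i)
        * pseudoinverse_on V (laplacian V E) i j
        * (indicat_real {u} j - indicat_real {v} j))"

definition resistance_curvature :: "'v set \<Rightarrow> 'v set set \<Rightarrow> 'v \<Rightarrow> real" where
  "resistance_curvature V E v =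
     1 - 1 / 2 * (\<Sum>u\<in>neighbours V E v. effective_resistance V E u v)"

definition polytope_vertices :: "'a::euclidean_space set \<Rightarrow> 'a set" where
  "polytope_vertices P = {v. v extreme_point_of P}"

definition polytope_edges :: "'a::euclidean_space set \<Rightarrow> 'a set set" where
  "polytope_edges P = {{u, v} |u v. closed_segment u v edge_of P}"

definition resistance_positive :: "'a::euclidean_space set \<Rightarrow> bool" where
  "resistance_positive P \<longleftrightarrow>
     (\<forall>v\<in>polytope_vertices P.
        resistance_curvature (polytope_vertices P) (polytope_edges P) v > 0)"

(* Isomorphism of the face lattices, ordered by inclusion; the empty face and the whole polytope
   count as faces. *)
definition combinatorially_equivalent ::
    "'a::euclidean_space set \<Rightarrow> 'b::euclidean_space set \<Rightarrow> bool" where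
  "combinatorially_equivalent P Q \<longleftrightarrow>
     (\<exists>\<phi>. bij_betw \<phi> {F. F face_of P} {F. F face_of Q} \<and>
       (\<forall>F G. F face_of P \<longrightarrow> G face_of P \<longrightarrow> (\<phi> F \<subseteq> \<phi> G \<longleftrightarrow> F \<subseteq> G)))"

end

(* For a symmetric matrix M, a linear relation between its powers, after cancelling superfluous
   factors M, gives M = M^2 S with S a polynomial in M, and then M S^2 is the pseudoinverse.
   The curvatures of a graph sum to |V| - tr(L L^+). Since I - L L^+ is a symmetric idempotent, the
   sum equals its squared Frobenius norm, which is positive because the columns of L L^+ sum to 0.
   So the common value of the curvature on a vertex-transitive graph is positive; neither
   connectedness nor knowledge of the edges is needed. The product of a regular n-gon with a cube
   of dimension d - 2 has a linear symmetry group that is transitive on its vertices, and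
   these products are told apart by their numbers of vertices. *)
theory Submission
  imports Defs
begin

section \<open>Linear algebra of real symmetric matrices\<close>

subsection \<open>The pseudoinverse of a symmetric matrix\<close>

text \<open>Gaussian elimination, by induction on the coordinate set \<open>A\<close>: a pivot
  \<open>p\<close> with \<open>f p a \<noteq> 0\<close> clears the coordinate \<open>a\<close> from
  all other vectors, at the price of one vector and one coordinate. It is applied below to the
  powers of a matrix, with matrix entries as coordinates.\<close>

lemma nontrivial_linear_relation:
  fixes f :: "'i \<Rightarrow> 'a \<Rightarrow> 'k::field"
  assumes "finite A" "finite I" "card A < card I"
  shows "\<exists>c. (\<exists>i\<in>I. c i \<noteq> 0) \<and> (\<forall>a\<in>A. (\<Sum>i\<in>I. c i * f i a) = 0)"
  using assms
proof (induction A arbitrary: I f rule: finite_induct)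
  case empty
  then have "I \<noteq> {}" by auto
  then show ?case by (intro exI[of _ "\<lambda>_. 1"]) auto
next
  case (insert a A)
  show ?case
  proof (cases "\<exists>p\<in>I. f p a \<noteq> 0")
    case False
    have "\<exists>c. (\<exists>i\<in>I. c i \<noteq> 0) \<and> (\<forall>a\<in>A. (\<Sum>i\<in>I. c i * f i a) = 0)"
      using insert by (intro insert.IH) auto
    then obtain c where "\<exists>i\<in>I. c i \<noteq> 0" "\<forall>a\<in>A. (\<Sum>i\<in>I. c i * f i a) = 0"
      by blast
    with False show ?thesis by (intro exI[of _ c]) auto
  next
    case True
    then obtain p where p: "p \<in> I" "f p a \<noteq> 0" by blast
    define g where "g i x = f i x - f i a / f p a * f p x" for i x
    have "card A < card (I - {p})"
      using insert p by (simp add: card_Diff_singleton)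
    then obtain c where c: "\<exists>i\<in>I - {p}. c i \<noteq> 0" "\<forall>x\<in>A. (\<Sum>i\<in>I - {p}. c i * g i x) = 0"
      using insert.IH[of "I - {p}" g] insert.prems by auto
    \<comment> \<open>The coefficient of the pivot collects the multiples of \<open>f p\<close>
      subtracted in \<open>g\<close>, so the relation among the \<open>g i\<close> becomes one among
      the \<open>f i\<close>.\<close>
    define c' where "c' = c(p := - (\<Sum>i\<in>I - {p}. c i * (f i a / f p a)))"
    have sum_c': "(\<Sum>i\<in>I. c' i * f i x) = (\<Sum>i\<in>I - {p}. c i * g i x)" for x
    proof -
      have "(\<Sum>i\<in>I. c' i * f i x) = c' p * f p x + (\<Sum>i\<in>I - {p}. c i * f i x)"
        using p insert.prems by (subst sum.remove[of _ p]) (auto simp: c'_def intro!: sum.cong)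
      also have "\<dots> = (\<Sum>i\<in>I - {p}. c i * g i x)"
        unfolding c'_def g_def right_diff_distrib sum_subtractf
        by (simp add: sum_distrib_right mult.assoc)
      finally show ?thesis .
    qed
    have "(\<Sum>i\<in>I. c' i * f i a) = 0"
      unfolding sum_c' using p by (simp add: g_def)
    with c have "\<forall>x\<in>insert a A. (\<Sum>i\<in>I. c' i * f i x) = 0"
      by (simp add: sum_c')
    moreover have "\<exists>i\<in>I. c' i \<noteq> 0"
      using c(1) by (auto simp: c'_def)
    ultimately show ?thesis by blast
  qed
qed

text \<open>The identity matrix is cut off outside \<open>V\<close>, and the context below asks the
  same of \<open>M\<close>; identities between powers then hold as equations of functions, not only
  on \<open>V \<times> V\<close>.\<close>

primrec mat_power_on :: "'v set \<Rightarrow> 'v mat_on \<Rightarrow> nat \<Rightarrow> 'v mat_on" where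
  "mat_power_on V M 0 = (\<lambda>i j. if i = j \<and> i \<in> V then 1 else 0)"
| "mat_power_on V M (Suc n) = mat_mult_on V M (mat_power_on V M n)"

context
  fixes V :: "'v set" and M :: "'v mat_on"
  assumes fin: "finite V"
    and sym: "\<And>i j. M i j = M j i"
    and supp: "\<And>i j. i \<notin> V \<or> j \<notin> V \<Longrightarrow> M i j = 0"
begin

lemma mat_power_on_Suc2: "mat_power_on V M (Suc n) = mat_mult_on V (mat_power_on V M n) M"
proof (induction n)
  case 0
  show ?case
  proof (intro ext)
    fix i j
    show "mat_power_on V M (Suc 0) i j = mat_mult_on V (mat_power_on V M 0) M i j"
      using fin supp
      by (cases "i \<in> V") (auto simp: mat_mult_on_def if_distrib if_distribR cong: if_cong)
  qed
next
  case (Suc n)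
  then show ?case by (metis mat_mult_on_assoc mat_power_on.simps(2))
qed

lemma mat_power_on_1: "mat_power_on V M (Suc 0) = M"
  using fin supp by (intro ext) (auto simp: mat_mult_on_def if_distrib if_distribR cong: if_cong)

lemma mat_power_on_sym: "mat_power_on V M n i j = mat_power_on V M n j i"
proof (induction n arbitrary: i j)
  case (Suc n)
  have "mat_power_on V M (Suc n) i j = (\<Sum>k\<in>V. mat_power_on V M n j k * M k i)"
    unfolding mat_power_on.simps mat_mult_on_def using Suc sym by (simp add: mult.commute)
  also have "\<dots> = mat_power_on V M (Suc n) j i"
    unfolding mat_power_on_Suc2 by (simp add: mat_mult_on_def)
  finally show ?case .
qed auto

lemma mat_power_on_supp: "i \<notin> V \<or> j \<notin> V \<Longrightarrow> mat_power_on V M n i j = 0"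
proof (induction n arbitrary: i j)
  case (Suc n)
  then show ?case by (auto simp: mat_mult_on_def supp)
qed auto

text \<open>The separate exponent map \<open>g\<close> lets multiplication by \<open>M\<close> shift
  exponents while the index set and the coefficients stay fixed.\<close>

definition mat_poly_on :: "nat set \<Rightarrow> (nat \<Rightarrow> real) \<Rightarrow> (nat \<Rightarrow> nat) \<Rightarrow> 'v mat_on" where
  "mat_poly_on J c g = (\<lambda>i j. \<Sum>n\<in>J. c n * mat_power_on V M (g n) i j)"

lemma mult_mat_poly_on: "mat_mult_on V M (mat_poly_on J c g) = mat_poly_on J c (\<lambda>n. Suc (g n))"
  unfolding mat_poly_on_def mat_power_on.simps mat_mult_on_def
  by (intro ext, simp add: sum_distrib_left, subst sum.swap, simp add: mult_ac)

lemma mat_poly_on_mult: "mat_mult_on V (mat_poly_on J c g) M = mat_poly_on J c (\<lambda>n. Suc (g n))"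
  unfolding mat_poly_on_def mat_power_on_Suc2 mat_mult_on_def
  by (intro ext, simp add: sum_distrib_left sum_distrib_right, subst sum.swap, simp add: mult_ac)

lemma mat_poly_on_sym: "mat_poly_on J c g i j = mat_poly_on J c g j i"
  unfolding mat_poly_on_def by (subst mat_power_on_sym) (rule refl)

lemma mat_poly_on_supp: "i \<notin> V \<or> j \<notin> V \<Longrightarrow> mat_poly_on J c g i j = 0"
  unfolding mat_poly_on_def using mat_power_on_supp by (auto intro!: sum.neutral)

text \<open>Let Y be the polynomial in the conclusion. It has the form p M with p a polynomial in
  \<open>M\<close>, and M Y = 0, so Y Y = p (M Y) = 0. As Y is symmetric, the diagonal entries of Y
  Y are sums of squares of the entries in a row, so Y = 0.\<close>

lemma mat_poly_on_cancel:
  assumes "mat_poly_on J c (\<lambda>n. Suc (Suc (g n))) = (\<lambda>i j. 0)"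
  shows "mat_poly_on J c (\<lambda>n. Suc (g n)) = (\<lambda>i j. 0)"
proof (intro ext)
  let ?m = "mat_mult_on V"
  let ?Y = "mat_poly_on J c (\<lambda>n. Suc (g n))"
  fix i j
  have "?m ?Y ?Y = ?m (mat_poly_on J c g) (?m M ?Y)"
    by (simp add: mat_poly_on_mult[symmetric] mat_mult_on_assoc)
  also have "\<dots> = (\<lambda>i j. 0)"
    by (simp add: mult_mat_poly_on assms) (simp add: mat_mult_on_def)
  finally have "(\<Sum>k\<in>V. (?Y i k)\<^sup>2) = 0"
    unfolding mat_mult_on_def fun_eq_iff power2_eq_square
    by (metis (no_types, lifting) mat_poly_on_sym sum.cong)
  then show "?Y i j = 0"
    using fin mat_poly_on_supp[of i j] by (cases "j \<in> V") (auto simp: sum_nonneg_eq_0_iff)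
qed

text \<open>If \<open>k\<close> is the lowest exponent in a relation between powers of
  \<open>M\<close>, cancellation lowers it to 1. Solving for the lowest term then expresses
  \<open>M\<close> as a combination of powers with exponent at least 2, and dividing by M^2 gives
  \<open>S\<close>.\<close>

lemma symmetric_group_inverse:
  "\<exists>S. mat_mult_on V M (mat_mult_on V M S) = M \<and> mat_mult_on V M S = mat_mult_on V S M \<and>
    (\<forall>i j. S i j = S j i) \<and> (\<forall>i j. i \<notin> V \<or> j \<notin> V \<longrightarrow> S i j = 0)"
proof -
  \<comment> \<open>The powers with exponents 0 to \<open>N\<close> are one more in number than the
    entries of a matrix on \<open>V\<close>.\<close>
  define N where "N = card (V \<times> V)"
  obtain c where c: "\<exists>n\<in>{..N}. c n \<noteq> 0"
      "\<forall>a\<in>V \<times> V. (\<Sum>n\<in>{..N}. c n * mat_power_on V M n (fst a) (snd a)) = 0"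
    using nontrivial_linear_relation[of "V \<times> V" "{..N}" "\<lambda>n a. mat_power_on V M n (fst a) (snd a)"] fin
    by (auto simp: N_def)
  define k where "k = (LEAST n. c n \<noteq> 0)"
  have k: "c k \<noteq> 0"
    unfolding k_def using c(1) LeastI[of "\<lambda>n. c n \<noteq> 0"] by blast
  have below: "c n = 0" if "n < k" for n
    using that unfolding k_def by (blast dest: not_less_Least)
  have "k \<le> N"
    using c(1) below by (meson atMost_iff leI le_trans not_less)
  define J where "J = {k<..N}"
  have J: "{k..N} = insert k J" "finite J" "k \<notin> J"
    using \<open>k \<le> N\<close> by (auto simp: J_def)
  have rel: "mat_poly_on {k..N} c (\<lambda>n. n) = (\<lambda>i j. 0)"
  proof (intro ext)
    fix i j
    have "mat_poly_on {k..N} c (\<lambda>n. n) i j = mat_poly_on {..N} c (\<lambda>n. n) i j"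
      unfolding mat_poly_on_def using below
      by (intro sum.mono_neutral_left) (auto simp: not_le)
    also have "\<dots> = 0"
      using c(2) mat_poly_on_supp[of i j] by (cases "i \<in> V \<and> j \<in> V") (auto simp: mat_poly_on_def)
    finally show "mat_poly_on {k..N} c (\<lambda>n. n) i j = 0" .
  qed
  \<comment> \<open>Start at \<open>m = k\<close>, the relation multiplied once by \<open>M\<close>,
    and descend to \<open>m = 0\<close> by one cancellation at a time. The \<open>Suc\<close> is
    there because cancellation stops at lowest exponent 1: the matrix may be singular.\<close>
  have "mat_poly_on {k..N} c (\<lambda>n. Suc (n - k + m)) = (\<lambda>i j. 0)" if "m \<le> k" for m
    using that
  proof (induction rule: inc_induct)
    case base
    have "mat_poly_on {k..N} c (\<lambda>n. Suc (n - k + k)) = mat_poly_on {k..N} c (\<lambda>n. Suc n)"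
      unfolding mat_poly_on_def by (intro ext sum.cong) auto
    also have "\<dots> = (\<lambda>i j. 0)"
      by (simp add: mult_mat_poly_on[symmetric] rel) (simp add: mat_mult_on_def)
    finally show ?case .
  next
    case (step m)
    then show ?case using mat_poly_on_cancel[of "{k..N}" c "\<lambda>n. n - k + m"] by simp
  qed
  from this[of 0] have rel1: "mat_poly_on {k..N} c (\<lambda>n. Suc (n - k)) = (\<lambda>i j. 0)"
    by simp
  \<comment> \<open>All \<open>n\<close> in \<open>J\<close> exceed \<open>k\<close>, so the
    subtraction is not truncated.\<close>
  define S where "S = mat_poly_on J (\<lambda>n. - c n / c k) (\<lambda>n. n - Suc k)"
  show ?thesis
  proof (intro exI[of _ S] conjI allI impI)
    show "mat_mult_on V M (mat_mult_on V M S) = M"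
    proof (intro ext)
      fix i j
      have "mat_mult_on V M (mat_mult_on V M S) i j = mat_poly_on J (\<lambda>n. - c n / c k) (\<lambda>n. Suc (n - k)) i j"
        unfolding S_def mult_mat_poly_on unfolding mat_poly_on_def
        by (intro sum.cong) (auto simp: J_def Suc_diff_Suc simp del: mat_power_on.simps)
      also have "\<dots> = - mat_poly_on J c (\<lambda>n. Suc (n - k)) i j / c k"
        by (simp add: mat_poly_on_def sum_divide_distrib sum_negf)
      also have "\<dots> = M i j"
        using fun_cong[OF fun_cong[OF rel1], of i j] J k mat_power_on_1
        by (simp add: mat_poly_on_def field_simps del: mat_power_on.simps)
      finally show "mat_mult_on V M (mat_mult_on V M S) i j = M i j" .
    qed
    show "mat_mult_on V M S = mat_mult_on V S M"
      by (simp add: S_def mult_mat_poly_on mat_poly_on_mult)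
    show "S i j = S j i" for i j
      unfolding S_def by (rule mat_poly_on_sym)
    show "S i j = 0" if "i \<notin> V \<or> j \<notin> V" for i j
      unfolding S_def using that by (rule mat_poly_on_supp)
  qed
qed

end

text \<open>\<open>pseudoinverse_on\<close> is a definite description, so its Penrose conditions
  become available only once some pseudoinverse is exhibited.\<close>

lemma pseudoinverse_on_symmetric:
  assumes fin: "finite V" and sym: "\<And>i j. i \<in> V \<Longrightarrow> j \<in> V \<Longrightarrow> M i j = M j i"
  shows "is_pseudoinverse_on V M (pseudoinverse_on V M)"
proof -
  let ?m = "mat_mult_on V"
  \<comment> \<open>Cutting \<open>M\<close> off outside \<open>V\<close> meets the support
    assumption above; the Penrose conditions see only entries on \<open>V\<close>.\<close>
  define M' where "M' = (\<lambda>i j. if i \<in> V \<and> j \<in> V then M i j else 0)"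
  have M': "M' i j = M' j i" "i \<notin> V \<or> j \<notin> V \<Longrightarrow> M' i j = 0" for i j
    using sym by (auto simp: M'_def)
  have "\<exists>S. ?m M' (?m M' S) = M' \<and> ?m M' S = ?m S M' \<and>
      (\<forall>i j. S i j = S j i) \<and> (\<forall>i j. i \<notin> V \<or> j \<notin> V \<longrightarrow> S i j = 0)"
    by (rule symmetric_group_inverse[of V M', OF fin]) (fact M')+
  then obtain S where S: "?m M' (?m M' S) = M'" "?m M' S = ?m S M'" "\<And>i j. S i j = S j i"
      "\<And>i j. i \<notin> V \<or> j \<notin> V \<Longrightarrow> S i j = 0"
    by blast
  \<comment> \<open>Both products of \<open>X\<close> with \<open>M'\<close> equal
    \<open>M' S\<close>. The form M' S^2 yields the condition X M' X = X, which \<open>S\<close>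
    itself need not satisfy.\<close>
  define X where "X = ?m M' (?m S S)"
  have MX: "?m M' X = ?m M' S"
    unfolding X_def using S(1) by (metis mat_mult_on_assoc)
  have XM: "?m X M' = ?m M' S"
    unfolding X_def using S(1,2) by (metis mat_mult_on_assoc)
  have symMS: "?m M' S i j = ?m M' S j i" for i j
  proof -
    have "?m M' S i j = ?m (\<lambda>i j. M' j i) (\<lambda>i j. S j i) i j"
      using S(3) sym by (simp add: mat_mult_on_def M'_def cong: if_cong)
    also have "\<dots> = ?m M' S j i"
      using mat_mult_on_transpose[of V M' S i j] S(2) by simp
    finally show ?thesis .
  qed
  have "?m (?m M' X) M' = M'"
    unfolding MX using S(1,2) by (metis mat_mult_on_assoc)
  moreover have "?m (?m X M') X = X"
    unfolding XM using S(1,2) X_def by (metis mat_mult_on_assoc)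
  ultimately have "is_pseudoinverse_on V M' X"
    by (simp add: is_pseudoinverse_on_def MX XM symMS[symmetric])
  then have "is_pseudoinverse_on V M X"
    unfolding is_pseudoinverse_on_def by (simp add: mat_mult_on_def M'_def cong: sum.cong)
  moreover have "X i j = 0" if "i \<notin> V \<or> j \<notin> V" for i j
    using that S(4) unfolding X_def by (auto simp: mat_mult_on_def M'_def)
  ultimately show ?thesis
    using pseudoinverse_on_eqI by metis
qed

section \<open>Laplacians, effective resistances and total curvature\<close>

subsection \<open>Curvature of vertex-transitive graphs\<close>

lemma sum_if_eq_mult:
  fixes f g :: "'i \<Rightarrow> real"
  assumes "finite V" "v \<in> V"
  shows "(\<Sum>k\<in>V. (if v = k then f k else 0) * g k) = f v * g v"
  using assms by (subst sum.remove[of _ v]) (auto intro!: sum.neutral split: if_splits)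

lemma sum_indicator_singleton_mult:
  assumes "finite V" "u \<in> V"
  shows "(\<Sum>i\<in>V. indicat_real {u} i * f i) = f u"
  using assms by (simp add: indicator_def of_bool_def if_distrib if_distribR cong: if_cong)

lemma effective_resistance_eq:
  fixes E :: "'v set set"
  assumes "finite V" "u \<in> V" "v \<in> V"
  defines "X \<equiv> pseudoinverse_on V (laplacian V E)"
  shows "effective_resistance V E u v = X u u - X u v - X v u + X v v"
proof -
  have "effective_resistance V E u v =
      (\<Sum>i\<in>V. (indicat_real {u} i - indicat_real {v} i) *
        (\<Sum>j\<in>V. (indicat_real {u} j - indicat_real {v} j) * X i j))"
    unfolding effective_resistance_def X_def by (simp add: sum_distrib_left mult_ac)
  also have "\<dots> = X u u - X u v - X v u + X v v"
    unfolding left_diff_distrib sum_subtractf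
      sum_indicator_singleton_mult[OF assms(1,2)] sum_indicator_singleton_mult[OF assms(1,3)]
    by simp
  finally show ?thesis .
qed

lemma adjacency_matrix_sym: "adjacency_matrix E u v = adjacency_matrix E v u"
  by (simp add: adjacency_matrix_def insert_commute)

lemma sum_neighbours:
  assumes "finite V"
  shows "(\<Sum>u\<in>neighbours V E v. f u) = (\<Sum>u\<in>V. adjacency_matrix E v u * f u)"
  using assms unfolding neighbours_def adjacency_matrix_def
  by (auto simp: sum.inter_filter insert_commute intro!: sum.cong)

lemma laplacian_eq:
  assumes "finite V"
  shows "laplacian V E u v =
    (if u = v then \<Sum>w\<in>V. adjacency_matrix E u w else 0) - adjacency_matrix E u v"
  using sum_neighbours[OF assms, of "\<lambda>_. 1" E u]
  by (auto simp: laplacian_def degree_matrix_def)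

lemma laplacian_sym: "laplacian V E u v = laplacian V E v u"
  using adjacency_matrix_sym[of E u v] by (simp add: laplacian_def degree_matrix_def)

lemma laplacian_pseudoinverse:
  "finite V \<Longrightarrow> is_pseudoinverse_on V (laplacian V E) (pseudoinverse_on V (laplacian V E))"
  by (rule pseudoinverse_on_symmetric) (auto intro: laplacian_sym)

lemma sum_laplacian:
  assumes "finite V" "v \<in> V"
  shows "(\<Sum>u\<in>V. laplacian V E u v) = 0"
proof -
  have "(\<Sum>u\<in>V. laplacian V E u v) = (\<Sum>u\<in>V. laplacian V E v u)"
    by (intro sum.cong laplacian_sym refl)
  also have "\<dots> = 0"
    using assms by (simp add: laplacian_eq sum_subtractf)
  finally show ?thesis .
qed

text \<open>A form of Foster's theorem: the resistances of the edges add up to the trace of L L^+.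
  Summed over ordered adjacent pairs, the two diagonal terms of the resistance contribute
  \<open>S\<close> each and the two mixed terms \<open>T\<close> each, by symmetry of the adjacency
  matrix, and \<open>S - T\<close> is the trace.\<close>

lemma sum_resistance_curvature:
  assumes fin: "finite V"
  shows "(\<Sum>v\<in>V. resistance_curvature V E v) =
    real (card V) - (\<Sum>v\<in>V. mat_mult_on V (laplacian V E) (pseudoinverse_on V (laplacian V E)) v v)"
proof -
  define X where "X = pseudoinverse_on V (laplacian V E)"
  define A where "A = adjacency_matrix E"
  define S where "S = (\<Sum>v\<in>V. \<Sum>u\<in>V. A v u * X v v)"
  define T where "T = (\<Sum>v\<in>V. \<Sum>u\<in>V. A v u * X u v)"
  have A: "A u v = A v u" for u v
    unfolding A_def by (rule adjacency_matrix_sym)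
  have S: "(\<Sum>v\<in>V. \<Sum>u\<in>V. A v u * X u u) = S"
    unfolding S_def by (subst sum.swap) (simp add: A)
  have T: "(\<Sum>v\<in>V. \<Sum>u\<in>V. A v u * X v u) = T"
    unfolding T_def by (subst sum.swap) (simp add: A)
  have "(\<Sum>v\<in>V. resistance_curvature V E v) =
      (\<Sum>v\<in>V. 1 - 1/2 * (\<Sum>u\<in>V. A v u * (X u u - X u v - X v u + X v v)))"
    unfolding resistance_curvature_def A_def X_def using fin
    by (intro sum.cong refl) (simp add: sum_neighbours effective_resistance_eq cong: sum.cong)
  also have "\<dots> = real (card V) - 1/2 * (S - T - T + S)"
    unfolding S[symmetric] T[symmetric] sum_subtractf sum_distrib_left[symmetric]
    unfolding S T
    by (simp add: right_diff_distrib distrib_left sum.distrib sum_subtractf S T)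
       (simp add: S_def T_def)
  also have "\<dots> = real (card V) - (S - T)"
    by (simp add: field_simps)
  also have "S - T = (\<Sum>v\<in>V. mat_mult_on V (laplacian V E) X v v)"
  proof -
    have "mat_mult_on V (laplacian V E) X v v = (\<Sum>u\<in>V. A v u * X v v) - (\<Sum>u\<in>V. A v u * X u v)"
      if "v \<in> V" for v
      using that fin
      by (simp add: mat_mult_on_def laplacian_eq left_diff_distrib sum_subtractf A_def
          sum_if_eq_mult sum_distrib_right)
    then show ?thesis by (simp add: S_def T_def sum_subtractf)
  qed
  finally show ?thesis by (simp add: X_def)
qed

text \<open>The trace of the symmetric idempotent I - P is the sum of the squares of its entries. If
  it vanished, P would be the identity, whose columns sum to 1, whereas the columns of P inherit the
  sum 0 from the Laplacian.\<close>

lemma sum_resistance_curvature_pos: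
  fixes V :: "'v set"
  assumes fin: "finite V" and "V \<noteq> {}"
  shows "(\<Sum>v\<in>V. resistance_curvature V E v) > 0"
proof -
  define X where "X = pseudoinverse_on V (laplacian V E)"
  define P where "P = mat_mult_on V (laplacian V E) X"
  define I :: "'v mat_on" where "I = (\<lambda>i j. if i = j then 1 else 0)"
  have X: "is_pseudoinverse_on V (laplacian V E) X"
    unfolding X_def using fin by (rule laplacian_pseudoinverse)
  have sym: "P i j = P j i" if "i \<in> V" "j \<in> V" for i j
    using X that unfolding is_pseudoinverse_on_def P_def by blast
  have idem: "mat_mult_on V P P i j = P i j" if "i \<in> V" "j \<in> V" for i j
  proof -
    have "mat_mult_on V P P i j = mat_mult_on V (mat_mult_on V P (laplacian V E)) X i j"
      by (simp add: P_def mat_mult_on_assoc)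
    also have "\<dots> = P i j"
      unfolding P_def
      by (rule mat_mult_on_cong) (use X that in \<open>auto simp: is_pseudoinverse_on_def\<close>)
    finally show ?thesis .
  qed
  have "(\<Sum>j\<in>V. (I i j - P i j)\<^sup>2) = 1 - P i i" if "i \<in> V" for i
  proof -
    have "(\<Sum>j\<in>V. (I i j - P i j)\<^sup>2) = (\<Sum>j\<in>V. I i j) - 2 * (\<Sum>j\<in>V. I i j * P i j) + (\<Sum>j\<in>V. P i j * P j i)"
      unfolding sum_distrib_left sum_subtractf[symmetric] sum.distrib[symmetric]
      using sym that by (intro sum.cong) (auto simp: I_def power2_eq_square algebra_simps)
    also have "(\<Sum>j\<in>V. P i j * P j i) = P i i"
      using idem[OF that that] by (simp add: mat_mult_on_def)
    finally show ?thesis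
      using fin that by (simp add: I_def sum_if_eq_mult)
  qed
  then have trace: "(\<Sum>v\<in>V. resistance_curvature V E v) = (\<Sum>i\<in>V. \<Sum>j\<in>V. (I i j - P i j)\<^sup>2)"
    using sum_resistance_curvature[OF fin, of E] by (simp add: sum_subtractf P_def X_def)
  have "\<exists>i\<in>V. \<exists>j\<in>V. P i j \<noteq> I i j"
  proof (rule ccontr)
    assume *: "\<not> ?thesis"
    obtain v where v: "v \<in> V" using \<open>V \<noteq> {}\<close> by blast
    have "(\<Sum>i\<in>V. P i v) = (\<Sum>k\<in>V. (\<Sum>i\<in>V. laplacian V E i k) * X k v)"
      unfolding P_def mat_mult_on_def sum_distrib_right by (rule sum.swap)
    also have "\<dots> = 0" using fin by (simp add: sum_laplacian)
    finally have "(\<Sum>i\<in>V. I i v) = 0" using * v by simp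
    with v fin show False by (simp add: I_def)
  qed
  then obtain i j where ij: "i \<in> V" "j \<in> V" "P i j \<noteq> I i j" by blast
  show ?thesis
    unfolding trace
  proof (rule sum_pos2[OF fin \<open>i \<in> V\<close>])
    show "(\<Sum>j\<in>V. (I i j - P i j)\<^sup>2) > 0"
      using ij by (intro sum_pos2[OF fin \<open>j \<in> V\<close>]) auto
  qed (auto intro: sum_nonneg)
qed

text \<open>Relabelling by \<sigma> preserves matrix products and fixes the Laplacian, so the
  relabelled pseudoinverse is again a pseudoinverse of it; uniqueness makes the resistances
  invariant.\<close>

lemma resistance_curvature_automorphism:
  assumes fin: "finite V" and bij: "bij_betw \<sigma> V V"
    and edges: "\<And>u v. u \<in> V \<Longrightarrow> v \<in> V \<Longrightarrow> {\<sigma> u, \<sigma> v} \<in> E \<longleftrightarrow> {u, v} \<in> E"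
    and v: "v \<in> V"
  shows "resistance_curvature V E (\<sigma> v) = resistance_curvature V E v"
proof -
  define L where "L = laplacian V E"
  define X where "X = pseudoinverse_on V L"
  define X' where "X' = (\<lambda>i j. X (\<sigma> i) (\<sigma> j))"
  have \<sigma>: "\<sigma> u \<in> V" if "u \<in> V" for u
    using bij that by (auto simp: bij_betw_def)
  have inj: "inj_on \<sigma> (neighbours V E u)" for u
    using bij by (rule bij_betw_imp_inj_on[THEN inj_on_subset]) (auto simp: neighbours_def)
  have neigh: "neighbours V E (\<sigma> u) = \<sigma> ` neighbours V E u" if "u \<in> V" for u
  proof -
    have "neighbours V E (\<sigma> u) = {x \<in> \<sigma> ` V. {x, \<sigma> u} \<in> E}"
      using bij by (simp add: neighbours_def bij_betw_def)
    then show ?thesis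
      using edges that by (auto simp: neighbours_def)
  qed
  have L: "L (\<sigma> i) (\<sigma> j) = L i j" if "i \<in> V" "j \<in> V" for i j
    using that bij edges inj
    by (auto simp: L_def laplacian_def degree_matrix_def adjacency_matrix_def neigh card_image
        dest: bij_betw_imp_inj_on inj_onD)
  have mult: "mat_mult_on V (\<lambda>i j. A (\<sigma> i) (\<sigma> j)) (\<lambda>i j. B (\<sigma> i) (\<sigma> j)) =
      (\<lambda>i j. mat_mult_on V A B (\<sigma> i) (\<sigma> j))" for A B :: "'a mat_on"
    unfolding mat_mult_on_def
    by (intro ext sum.reindex_bij_betw[OF bij, of "\<lambda>k. A _ k * B k _"])
  have X: "is_pseudoinverse_on V L X"
    unfolding X_def L_def using fin by (rule laplacian_pseudoinverse)
  have "is_pseudoinverse_on V (\<lambda>i j. L (\<sigma> i) (\<sigma> j)) X'"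
    using X \<sigma> unfolding is_pseudoinverse_on_def X'_def mult by blast
  then have "is_pseudoinverse_on V L X'"
    unfolding is_pseudoinverse_on_def by (simp add: mat_mult_on_def L cong: sum.cong)
  from is_pseudoinverse_on_unique[OF this X]
  have "X (\<sigma> i) (\<sigma> j) = X i j" if "i \<in> V" "j \<in> V" for i j
    using that by (simp add: X'_def)
  then have "effective_resistance V E (\<sigma> i) (\<sigma> j) = effective_resistance V E i j"
    if "i \<in> V" "j \<in> V" for i j
    using that fin \<sigma> by (simp add: effective_resistance_eq X_def L_def)
  then have "(\<Sum>u\<in>neighbours V E (\<sigma> v). effective_resistance V E u (\<sigma> v)) =
      (\<Sum>u\<in>neighbours V E v. effective_resistance V E u v)"
    unfolding neigh[OF v] sum.reindex[OF inj] o_def using v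
    by (intro sum.cong) (auto simp: neighbours_def)
  then show ?thesis
    by (simp add: resistance_curvature_def)
qed

text \<open>Transitivity makes each curvature equal to the average, whose sign is that of the total
  curvature.\<close>

lemma resistance_curvature_pos_transitive:
  assumes fin: "finite V" and v: "v \<in> V"
    and trans: "\<And>u. u \<in> V \<Longrightarrow> \<exists>\<sigma>. bij_betw \<sigma> V V \<and> \<sigma> v = u \<and>
      (\<forall>x\<in>V. \<forall>y\<in>V. {\<sigma> x, \<sigma> y} \<in> E \<longleftrightarrow> {x, y} \<in> E)"
  shows "resistance_curvature V E v > 0"
proof -
  have "resistance_curvature V E u = resistance_curvature V E v" if "u \<in> V" for u
    using trans[OF that] resistance_curvature_automorphism[OF fin _ _ v] by metis
  then have "(\<Sum>u\<in>V. resistance_curvature V E u) = real (card V) * resistance_curvature V E v"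
    by simp
  moreover have "(\<Sum>u\<in>V. resistance_curvature V E u) > 0"
    using fin v by (intro sum_resistance_curvature_pos) auto
  ultimately show ?thesis
    by (simp add: zero_less_mult_iff)
qed

section \<open>Vertices, symmetries and combinatorial types of polytopes\<close>

subsection \<open>Polytopes\<close>

text \<open>A point inside a segment is closer to the centre than one of the ends. The hull lies in
  the ball, so no point on the sphere is inside a segment of the hull.\<close>

lemma extreme_points_of_convex_hull_sphere:
  fixes V :: "'a::euclidean_space set"
  assumes "V \<subseteq> sphere c r"
  shows "{x. x extreme_point_of (convex hull V)} = V"
proof (intro equalityI subsetI)
  fix v assume v: "v \<in> V"
  have hull: "convex hull V \<subseteq> cball c r"
    using assms by (intro hull_minimal) auto
  have "v \<notin> open_segment x y" if "x \<in> convex hull V" "y \<in> convex hull V" for x y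
    using dist_decreases_open_segment[of v x y c] that hull v assms by fastforce
  then show "v \<in> {x. x extreme_point_of (convex hull V)}"
    using v by (auto simp: extreme_point_of_def hull_inc)
qed (auto dest: extreme_point_of_convex_hull)

lemma polytope_edges_iff: "{u, v} \<in> polytope_edges P \<longleftrightarrow> closed_segment u v edge_of P"
  unfolding polytope_edges_def by (auto simp: doubleton_eq_iff closed_segment_commute)

text \<open>An injective linear map permuting \<open>V\<close> maps the hull onto itself and
  preserves faces and their dimensions, so it acts on the 1-skeleton as an automorphism. The sphere
  guarantees that all of \<open>V\<close> consists of vertices.\<close>

lemma resistance_positive_convex_hull_orbit:
  fixes V :: "'a::euclidean_space set"
  assumes fin: "finite V" and sphere: "V \<subseteq> sphere c r"
    and trans: "\<And>x y. x \<in> V \<Longrightarrow> y \<in> V \<Longrightarrow> \<exists>T. linear T \<and> inj T \<and> T ` V = V \<and> T x = y"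
  shows "resistance_positive (convex hull V)"
proof -
  let ?P = "convex hull V"
  have V: "polytope_vertices ?P = V"
    unfolding polytope_vertices_def using sphere by (rule extreme_points_of_convex_hull_sphere)
  have "resistance_curvature V (polytope_edges ?P) v > 0" if v: "v \<in> V" for v
  proof (rule resistance_curvature_pos_transitive[OF fin v])
    fix u assume "u \<in> V"
    then obtain T where T: "linear T" "inj T" "T ` V = V" "T v = u"
      using trans v by blast
    have "T ` ?P = ?P"
      using T convex_hull_linear_image[of T V] by simp
    then have "closed_segment (T x) (T y) edge_of ?P \<longleftrightarrow> closed_segment x y edge_of ?P" for x y
      using T face_of_linear_image[of T "closed_segment x y" ?P]
      by (simp add: edge_of_def closed_segment_linear_image aff_dim_injective_linear_image)
    moreover have "bij_betw T V V"
      using T by (auto simp: bij_betw_def intro: inj_on_subset)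
    ultimately show "\<exists>\<sigma>. bij_betw \<sigma> V V \<and> \<sigma> v = u \<and>
        (\<forall>x\<in>V. \<forall>y\<in>V. {\<sigma> x, \<sigma> y} \<in> polytope_edges ?P \<longleftrightarrow> {x, y} \<in> polytope_edges ?P)"
      using T by (auto simp: polytope_edges_iff)
  qed
  then show ?thesis
    by (simp add: resistance_positive_def V)
qed

text \<open>This describes vertices as the atoms of the face lattice, hence by the order alone. A
  minimal nonempty face has an extreme point, which is itself a face and so exhausts it.\<close>

lemma singleton_face_iff_minimal:
  fixes P :: "'a::euclidean_space set"
  assumes "polytope P" and F: "F face_of P"
  shows "(\<exists>x. F = {x}) \<longleftrightarrow> F \<noteq> {} \<and> (\<forall>G. G face_of P \<longrightarrow> G \<subseteq> F \<longrightarrow> G = {} \<or> G = F)"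
proof
  assume R: "F \<noteq> {} \<and> (\<forall>G. G face_of P \<longrightarrow> G \<subseteq> F \<longrightarrow> G = {} \<or> G = F)"
  have "polytope F"
    using assms by (rule face_of_polytope_polytope)
  then obtain x where x: "x extreme_point_of F"
    using extreme_point_exists_convex[of F] R polytope_imp_compact polytope_imp_convex by blast
  then have "{x} face_of P"
    using F face_of_trans face_of_singleton by blast
  moreover have "x \<in> F" using x by (simp add: extreme_point_of_def)
  ultimately show "\<exists>x. F = {x}" using R by (metis empty_not_insert empty_subsetI insert_subset)
qed auto

text \<open>An isomorphism of face lattices sends the least face, which is empty, to the empty face,
  and therefore atoms to atoms.\<close>

lemma combinatorially_equivalent_card_vertices:
  assumes "polytope P" "polytope Q" "combinatorially_equivalent P Q"
  shows "card {x. x extreme_point_of P} = card {x. x extreme_point_of Q}"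
proof -
  obtain \<phi> where bij: "bij_betw \<phi> {F. F face_of P} {F. F face_of Q}"
    and mono: "\<And>F G. F face_of P \<Longrightarrow> G face_of P \<Longrightarrow> \<phi> F \<subseteq> \<phi> G \<longleftrightarrow> F \<subseteq> G"
    using assms(3) unfolding combinatorially_equivalent_def by blast
  have \<phi>: "\<phi> F face_of Q" if "F face_of P" for F
    using bij that by (auto simp: bij_betw_def)
  have surj: "\<exists>F. F face_of P \<and> \<phi> F = G" if "G face_of Q" for G
    using bij that unfolding bij_betw_def by (metis (mono_tags) image_iff mem_Collect_eq)
  have inj: "\<phi> F = \<phi> G \<longleftrightarrow> F = G" if "F face_of P" "G face_of P" for F G
    using mono that by (metis equalityI order_refl)
  have empty: "\<phi> {} = {}"
    using surj[of "{}"] mono by (metis empty_face_of empty_subsetI subset_empty)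
  have minimal: "(\<exists>x. \<phi> F = {x}) \<longleftrightarrow> (\<exists>x. F = {x})" if F: "F face_of P" for F
  proof -
    have "(\<forall>G. G face_of Q \<longrightarrow> G \<subseteq> \<phi> F \<longrightarrow> G = {} \<or> G = \<phi> F) \<longleftrightarrow>
        (\<forall>G. G face_of P \<longrightarrow> \<phi> G \<subseteq> \<phi> F \<longrightarrow> \<phi> G = {} \<or> \<phi> G = \<phi> F)"
      using surj \<phi> by blast
    also have "\<dots> \<longleftrightarrow> (\<forall>G. G face_of P \<longrightarrow> G \<subseteq> F \<longrightarrow> G = {} \<or> G = F)"
      using F mono inj empty by (metis empty_face_of)
    finally show ?thesis
      unfolding singleton_face_iff_minimal[OF assms(1) F] singleton_face_iff_minimal[OF assms(2) \<phi>[OF F]]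
      using F inj[OF F empty_face_of] empty by simp
  qed
  have card_faces: "card {x. x extreme_point_of S} = card {F. F face_of S \<and> (\<exists>x. F = {x})}"
    for S :: "'c::euclidean_space set"
  proof -
    have "{F. F face_of S \<and> (\<exists>x. F = {x})} = (\<lambda>x. {x}) ` {x. x extreme_point_of S}"
      by (auto simp: face_of_singleton)
    then show ?thesis by (simp add: card_image)
  qed
  have "{F. F face_of Q \<and> (\<exists>x. F = {x})} = \<phi> ` {F. F face_of P \<and> (\<exists>x. F = {x})}"
    using surj \<phi> minimal by (auto simp: image_iff) metis+
  moreover have "inj_on \<phi> {F. F face_of P \<and> (\<exists>x. F = {x})}"
    using inj by (auto simp: inj_on_def)
  ultimately show ?thesis
    by (simp add: card_faces card_image)
qed

section \<open>Products of regular polygons with cubes\<close>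

subsection \<open>Prisms\<close>

(* The product of a regular n-gon in the (a, b)-plane with a cube in the remaining coordinates of B. *)
definition prism_vertices :: "'a::euclidean_space set \<Rightarrow> 'a \<Rightarrow> 'a \<Rightarrow> nat \<Rightarrow> 'a set" where
  "prism_vertices B a b n = {x. (\<forall>i\<in>Basis - B. x \<bullet> i = 0) \<and> (\<forall>i\<in>B - {a, b}. \<bar>x \<bullet> i\<bar> = 1) \<and>
     Complex (x \<bullet> a) (x \<bullet> b) ^ n = 1}"

text \<open>With the (a, b)-plane read as the complex plane, this is multiplication by
  \<open>w\<close> there and a diagonal map on the other coordinates. It is used with
  \<open>w\<close> a root of unity and \<open>s\<close> a choice of signs: a rotation with
  reflections.\<close>

definition twist :: "'a::euclidean_space \<Rightarrow> 'a \<Rightarrow> complex \<Rightarrow> ('a \<Rightarrow> real) \<Rightarrow> 'a \<Rightarrow> 'a" where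
  "twist a b w s u = (let z = w * Complex (u \<bullet> a) (u \<bullet> b) in
     \<Sum>i\<in>Basis. (if i = a then Re z else if i = b then Im z else s i * (u \<bullet> i)) *\<^sub>R i)"

text \<open>A sample vertex above each root of unity \<open>z\<close>, with all cube coordinates
  equal to 1.\<close>

definition prism_point :: "'a::euclidean_space set \<Rightarrow> 'a \<Rightarrow> 'a \<Rightarrow> complex \<Rightarrow> 'a" where
  "prism_point B a b z =
     (\<Sum>i\<in>Basis. (if i = a then Re z else if i = b then Im z else if i \<in> B then 1 else 0) *\<^sub>R i)"

context
  fixes B :: "'a::euclidean_space set" and a b :: 'a
  assumes B: "B \<subseteq> Basis" and ab: "a \<in> B" "b \<in> B" "a \<noteq> b"
begin

lemma ab_Basis: "a \<in> Basis" "b \<in> Basis"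
  using B ab by auto

lemma twist_inner:
  "i \<in> Basis \<Longrightarrow> twist a b w s u \<bullet> i =
    (if i = a then Re (w * Complex (u \<bullet> a) (u \<bullet> b))
     else if i = b then Im (w * Complex (u \<bullet> a) (u \<bullet> b)) else s i * (u \<bullet> i))"
  unfolding twist_def Let_def by (subst inner_sum_left_Basis) auto

lemma prism_point_inner:
  "i \<in> Basis \<Longrightarrow> prism_point B a b z \<bullet> i =
    (if i = a then Re z else if i = b then Im z else if i \<in> B then 1 else 0)"
  unfolding prism_point_def by (subst inner_sum_left_Basis) auto

lemma linear_twist: "linear (twist a b w s)"
  by (intro linearI euclidean_eqI[where 'a='a])
    (auto simp: twist_inner inner_add_left algebra_simps)

lemma twist_complex:
  "Complex (twist a b w s u \<bullet> a) (twist a b w s u \<bullet> b) = w * Complex (u \<bullet> a) (u \<bullet> b)"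
  using ab ab_Basis by (simp add: twist_inner complex_eq_iff)

lemma twist_inverse:
  assumes "w \<noteq> 0" "\<And>i. \<bar>s i\<bar> = 1"
  shows "twist a b (inverse w) s (twist a b w s u) = u"
proof (rule euclidean_eqI)
  fix i :: 'a assume i: "i \<in> Basis"
  have s: "s i * (s i * t) = t" for t
    using assms(2)[of i] by (simp add: abs_if split: if_splits)
  have c: "inverse w * (w * Complex (u \<bullet> a) (u \<bullet> b)) = Complex (u \<bullet> a) (u \<bullet> b)"
    using assms(1) by (simp flip: mult.assoc)
  show "twist a b (inverse w) s (twist a b w s u) \<bullet> i = u \<bullet> i"
    unfolding twist_inner[OF i, of "inverse w"] twist_complex c
    by (simp add: i s twist_inner)
qed

lemma twist_prism_vertices:
  assumes "w ^ n = 1" "\<And>i. \<bar>s i\<bar> = 1" "u \<in> prism_vertices B a b n"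
  shows "twist a b w s u \<in> prism_vertices B a b n"
  unfolding prism_vertices_def mem_Collect_eq twist_complex
  using assms ab B by (auto simp: twist_inner prism_vertices_def power_mult_distrib abs_mult subset_iff)

text \<open>Rotate by the quotient of the two roots of unity and flip the cube coordinates in which
  \<open>x\<close> and \<open>y\<close> differ.\<close>

lemma prism_vertices_transitive:
  assumes "n > 0" and x: "x \<in> prism_vertices B a b n" and y: "y \<in> prism_vertices B a b n"
  shows "\<exists>T. linear T \<and> inj T \<and> T ` prism_vertices B a b n = prism_vertices B a b n \<and> T x = y"
proof -
  let ?V = "prism_vertices B a b n"
  define w where "w = Complex (y \<bullet> a) (y \<bullet> b) / Complex (x \<bullet> a) (x \<bullet> b)"
  \<comment> \<open>The product of two signs is 1 exactly where they agree. The default 1 makes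
    \<open>s\<close> a sign at every index, as \<open>twist_inverse\<close> requires.\<close>
  define s where "s i = (if i \<in> B - {a, b} then (x \<bullet> i) * (y \<bullet> i) else 1)" for i
  have x0: "Complex (x \<bullet> a) (x \<bullet> b) \<noteq> 0"
    using x \<open>n > 0\<close> by (auto simp: prism_vertices_def zero_power)
  have w: "w ^ n = 1" "w \<noteq> 0"
    using x y \<open>n > 0\<close> by (auto simp: w_def prism_vertices_def power_divide zero_power)
  have s: "\<bar>s i\<bar> = 1" for i
    using x y by (auto simp: s_def prism_vertices_def abs_mult)
  have inv: "twist a b (inverse w) s (twist a b w s u) = u"
      "twist a b w s (twist a b (inverse w) s u) = u" for u
    using twist_inverse[of w s u] twist_inverse[of "inverse w" s u] w s by simp_all
  have "twist a b w s x = y"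
  proof (rule euclidean_eqI)
    fix i :: 'a assume i: "i \<in> Basis"
    have "(x \<bullet> i) * (x \<bullet> i) = 1" if "i \<in> B - {a, b}"
      using x that by (metis (mono_tags, lifting) abs_mult_self_eq mem_Collect_eq mult_1 prism_vertices_def)
    moreover have "x \<bullet> i = 0" "y \<bullet> i = 0" if "i \<notin> B"
      using x y that i by (auto simp: prism_vertices_def)
    ultimately show "twist a b w s x \<bullet> i = y \<bullet> i"
      using i x0 by (auto simp: twist_inner w_def s_def mult_ac simp flip: mult.assoc)
  qed
  moreover have "inj (twist a b w s)"
    using inv(1) by (rule inj_on_inverseI)
  moreover have "twist a b w s ` ?V = ?V"
  proof
    show "?V \<subseteq> twist a b w s ` ?V"
    proof
      fix u assume "u \<in> ?V"
      then have "twist a b (inverse w) s u \<in> ?V"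
        using w s by (intro twist_prism_vertices) (auto simp: power_inverse)
      then show "u \<in> twist a b w s ` ?V"
        using inv(2)[of u] by (metis imageI)
    qed
  qed (use w s twist_prism_vertices in blast)
  ultimately show ?thesis
    using linear_twist by blast
qed

text \<open>All coordinates lie in the finite set \<open>C\<close> of real and imaginary parts of
  roots of unity together with -1, 0 and 1.\<close>

lemma finite_prism_vertices:
  assumes "n > 0"
  shows "finite (prism_vertices B a b n)"
proof -
  define R where "R = {z::complex. z ^ n = 1}"
  have "card R = n"
    unfolding R_def using assms by (rule card_roots_unity_eq)
  then have R: "finite R"
    using assms card_ge_0_finite by metis
  define C where "C = Re ` R \<union> Im ` R \<union> {-1, 0, 1}"
  have mem: "x \<in> (\<lambda>f. \<Sum>i\<in>Basis. f i *\<^sub>R i) ` (Basis \<rightarrow>\<^sub>E C)" if x: "x \<in> prism_vertices B a b n" for x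
  proof
    show "x = (\<Sum>i\<in>Basis. (\<lambda>i\<in>Basis. x \<bullet> i) i *\<^sub>R i)"
      by (simp add: euclidean_representation)
    have z: "Complex (x \<bullet> a) (x \<bullet> b) \<in> R"
      using x by (simp add: R_def prism_vertices_def)
    have "x \<bullet> i \<in> C" if i: "i \<in> Basis" for i
    proof -
      consider "i = a" | "i = b" | "i \<in> B - {a, b}" | "i \<in> Basis - B"
        using i by blast
      then show ?thesis
      proof cases
        case 1
        then show ?thesis using imageI[OF z, of Re] by (simp add: C_def)
      next
        case 2
        then show ?thesis using imageI[OF z, of Im] by (simp add: C_def)
      next
        case 3
        then have "\<bar>x \<bullet> i\<bar> = 1" using x by (simp add: prism_vertices_def)
        then show ?thesis by (auto simp: C_def abs_if split: if_splits)
      next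
        case 4
        then show ?thesis using x by (simp add: C_def prism_vertices_def)
      qed
    qed
    then show "(\<lambda>i\<in>Basis. x \<bullet> i) \<in> Basis \<rightarrow>\<^sub>E C"
      by auto
  qed
  have fin: "finite ((\<lambda>f. \<Sum>i\<in>Basis. f i *\<^sub>R i) ` (Basis \<rightarrow>\<^sub>E C))"
    using R by (intro finite_imageI finite_PiE) (auto simp: C_def)
  show ?thesis
    using subsetI[OF mem] fin by (rule finite_subset)
qed

lemma prism_point_in_vertices: "z ^ n = 1 \<Longrightarrow> prism_point B a b z \<in> prism_vertices B a b n"
  using ab B ab_Basis by (auto simp: prism_vertices_def prism_point_inner subset_iff)

text \<open>Projection to the (a, b)-plane reaches each of the \<open>n\<close> roots of unity. This
  makes the vertex numbers of the prisms unbounded.\<close>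

lemma card_prism_vertices_ge:
  assumes "n > 0"
  shows "n \<le> card (prism_vertices B a b n)"
proof -
  have "z \<in> (\<lambda>x. Complex (x \<bullet> a) (x \<bullet> b)) ` prism_vertices B a b n" if "z ^ n = 1" for z
    using prism_point_in_vertices[OF that] ab ab_Basis
    by (intro image_eqI[of _ _ "prism_point B a b z"]) (auto simp: prism_point_inner)
  then have "card {z::complex. z ^ n = 1} \<le> card (prism_vertices B a b n)"
    using finite_prism_vertices[OF assms] by (intro surj_card_le subsetI) simp_all
  then show ?thesis
    using card_roots_unity_eq[OF assms] by simp
qed

lemma prism_vertices_sphere:
  assumes "n > 0"
  shows "prism_vertices B a b n \<subseteq> sphere 0 (sqrt (1 + real (card (B - {a, b}))))"
proof
  fix x assume x: "x \<in> prism_vertices B a b n"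
  have "cmod (Complex (x \<bullet> a) (x \<bullet> b)) = 1"
    using x assms power_eq_1_iff[of "Complex (x \<bullet> a) (x \<bullet> b)" n] by (auto simp: prism_vertices_def)
  then have z: "(x \<bullet> a)\<^sup>2 + (x \<bullet> b)\<^sup>2 = 1"
    by (simp add: cmod_def)
  have "x \<bullet> x = (\<Sum>i\<in>Basis. (x \<bullet> i)\<^sup>2)"
    by (subst euclidean_inner) (simp add: power2_eq_square)
  also have "\<dots> = (\<Sum>i\<in>B. (x \<bullet> i)\<^sup>2)"
    using x B by (intro sum.mono_neutral_right) (auto simp: prism_vertices_def)
  also have "B = insert a (insert b (B - {a, b}))"
    using ab by blast
  also have "(\<Sum>i\<in>\<dots>. (x \<bullet> i)\<^sup>2) = (x \<bullet> a)\<^sup>2 + (x \<bullet> b)\<^sup>2 + (\<Sum>i\<in>B - {a, b}. (x \<bullet> i)\<^sup>2)"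
    using ab finite_subset[OF B] by simp
  also have "(\<Sum>i\<in>B - {a, b}. (x \<bullet> i)\<^sup>2) = (\<Sum>i\<in>B - {a, b}. 1)"
  proof (intro sum.cong refl)
    fix i assume "i \<in> B - {a, b}"
    then have "\<bar>x \<bullet> i\<bar> = 1"
      using x by (simp add: prism_vertices_def)
    then show "(x \<bullet> i)\<^sup>2 = 1"
      by (metis one_power2 power2_abs)
  qed
  finally show "x \<in> sphere 0 (sqrt (1 + real (card (B - {a, b}))))"
    using z by (simp add: norm_eq_sqrt_inner)
qed

text \<open>Divisibility by 4 puts 1, -1, \<i> and -\<i> among the roots of unity. Then the vertex
  set contains an antipodal pair, which reduces affine to linear dimension, and every vector of
  \<open>B\<close> is half a difference of two vertices.\<close>

lemma aff_dim_prism_vertices: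
  assumes n: "n > 0" "4 dvd n"
  shows "aff_dim (prism_vertices B a b n) = int (card B)"
proof -
  let ?V = "prism_vertices B a b n"
  obtain k where k: "n = 4 * k"
    using n by (auto elim: dvdE)
  have root: "z ^ n = 1" if "z ^ 4 = 1" for z :: complex
    unfolding k power_mult that by simp
  have p: "prism_point B a b z \<in> ?V" if "z ^ 4 = 1" for z
    using that by (intro prism_point_in_vertices root)
  have 4: "1 ^ 4 = (1::complex)" "(-1) ^ 4 = (1::complex)" "\<i> ^ 4 = 1" "(-\<i>) ^ 4 = 1"
    by (simp_all add: power4_eq_xxxx)
  have "- prism_point B a b 1 \<in> ?V"
    using p[OF 4(2)] ab B ab_Basis by (auto simp: prism_vertices_def prism_point_inner subset_iff)
  then have "0 \<in> affine hull ?V"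
    using mem_affine[OF affine_affine_hull, of "prism_point B a b 1" ?V "- prism_point B a b 1" "1/2" "1/2"]
      p[OF 4(1)] by (simp add: hull_inc)
  then have "aff_dim ?V = int (dim ?V)"
    by (rule aff_dim_zero)
  also have "dim ?V = card B"
  proof (rule dim_eq_card)
    show "independent B"
      using B independent_Basis independent_mono by blast
    have "?V \<subseteq> span B"
    proof
      fix x assume x: "x \<in> ?V"
      have "(x \<bullet> i) *\<^sub>R i \<in> span B" if "i \<in> Basis" for i
        using x that by (cases "i \<in> B") (auto simp: prism_vertices_def span_base span_scale span_zero)
      then have "(\<Sum>i\<in>Basis. (x \<bullet> i) *\<^sub>R i) \<in> span B"
        by (rule span_sum)
      then show "x \<in> span B"
        by (simp add: euclidean_representation)
    qed
    moreover have "B \<subseteq> span ?V"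
    proof
      fix i assume i: "i \<in> B"
      have "\<exists>x\<in>?V. \<exists>y\<in>?V. i = (1/2) *\<^sub>R (x - y)"
      proof -
        consider "i = a" | "i = b" | "i \<in> B - {a, b}"
          using i by blast
        then show ?thesis
        proof cases
          case 1
          have "a = (1/2) *\<^sub>R (prism_point B a b 1 - prism_point B a b (-1))"
            by (rule euclidean_eqI)
              (use ab_Basis ab in \<open>auto simp: prism_point_inner inner_diff_left inner_Basis\<close>)
          then show ?thesis using 1 p[OF 4(1)] p[OF 4(2)] by blast
        next
          case 2
          have "b = (1/2) *\<^sub>R (prism_point B a b \<i> - prism_point B a b (-\<i>))"
            by (rule euclidean_eqI)
              (use ab_Basis ab in \<open>auto simp: prism_point_inner inner_diff_left inner_Basis\<close>)
          then show ?thesis using 2 p[OF 4(3)] p[OF 4(4)] by blast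
        next
          case 3
          \<comment> \<open>This flips the cube coordinate \<open>i\<close> from 1 to -1.\<close>
          let ?y = "prism_point B a b 1 - 2 *\<^sub>R i"
          have "?y \<in> ?V"
            using p[OF 4(1)] 3 ab B ab_Basis
            by (auto simp: prism_vertices_def prism_point_inner subset_iff inner_diff_left inner_Basis)
          moreover have "i = (1/2) *\<^sub>R (prism_point B a b 1 - ?y)"
            by simp
          ultimately show ?thesis using p[OF 4(1)] by blast
        qed
      qed
      then show "i \<in> span ?V"
        by (auto intro: span_scale span_diff span_base)
    qed
    ultimately show "span B = span ?V"
      by (metis span_eq)
  qed
  finally show ?thesis .
qed

end

section \<open>An infinite family of prisms in each dimension\<close>

theorem theorem1p13:
  fixes d :: nat
  assumes "2 \<le> d" and "d \<le> DIM('a::euclidean_space)"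
  shows "\<exists>\<P> :: 'a set set. infinite \<P> \<and>
           (\<forall>P\<in>\<P>. polytope P \<and> aff_dim P = int d \<and> resistance_positive P) \<and>
           pairwise (\<lambda>P Q. \<not> combinatorially_equivalent P Q) \<P>"
proof -
  obtain B :: "'a set" where B: "B \<subseteq> Basis" "card B = d"
    using obtain_subset_with_card_n[OF assms(2)] by blast
  have "\<not> card B \<le> Suc 0"
    using assms(1) B(2) by simp
  then obtain a b where ab: "a \<in> B" "b \<in> B" "a \<noteq> b"
    using card_le_Suc0_iff_eq[of B] finite_subset[OF B(1) finite_Basis] by blast
  \<comment> \<open>The factor 4 serves the dimension count, and \<open>Suc\<close> keeps the
    polygon size positive.\<close>
  define V where "V m = prism_vertices B a b (4 * Suc m)" for m
  define P where "P m = convex hull V m" for m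
  have fin: "finite (V m)" for m
    unfolding V_def using B ab by (intro finite_prism_vertices) auto
  have sphere: "V m \<subseteq> sphere 0 (sqrt (1 + real (card (B - {a, b}))))" for m
    unfolding V_def using B ab by (intro prism_vertices_sphere) auto
  have vertices: "{x. x extreme_point_of P m} = V m" for m
    unfolding P_def using sphere by (rule extreme_points_of_convex_hull_sphere)
  have polytope: "polytope (P m)" for m
    unfolding P_def using fin by (auto simp: polytope_def)
  have dim: "aff_dim (P m) = int d" for m
    unfolding P_def V_def aff_dim_convex_hull B(2)[symmetric]
    using B ab by (intro aff_dim_prism_vertices) auto
  have pos: "resistance_positive (P m)" for m
    unfolding P_def
    by (rule resistance_positive_convex_hull_orbit[OF fin sphere])
      (use B ab in \<open>auto simp: V_def intro!: prism_vertices_transitive\<close>)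
  \<comment> \<open>From \<open>m < f m\<close> the vertex counts are unbounded, but
    \<open>f\<close> is not shown to be injective. The family is therefore indexed by the attained
    counts, with \<open>inv f\<close> choosing one prism for each.\<close>
  define f where "f m = card (V m)" for m
  have f: "m < f m" for m
    using card_prism_vertices_ge[OF B(1) ab, of "4 * Suc m"] by (simp add: f_def V_def)
  have "infinite (range f)"
    unfolding infinite_nat_iff_unbounded using f by blast
  moreover have inv: "card {x. x extreme_point_of P (inv f k)} = k" if "k \<in> range f" for k
    using f_inv_into_f[OF that] by (simp add: vertices f_def)
  then have "inj_on (\<lambda>k. P (inv f k)) (range f)"
    by (rule inj_on_inverseI)
  ultimately have "infinite ((\<lambda>k. P (inv f k)) ` range f)"
    using finite_imageD by blast
  moreover have "pairwise (\<lambda>P Q. \<not> combinatorially_equivalent P Q) ((\<lambda>k. P (inv f k)) ` range f)"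
  proof (rule pairwiseI)
    fix Q R
    assume QR: "Q \<noteq> R" and Q: "Q \<in> (\<lambda>k. P (inv f k)) ` range f" and R: "R \<in> (\<lambda>k. P (inv f k)) ` range f"
    obtain k where k: "Q = P (inv f k)" "k \<in> range f"
      using Q by (rule imageE)
    obtain l where l: "R = P (inv f l)" "l \<in> range f"
      using R by (rule imageE)
    have "k = l" if "combinatorially_equivalent Q R"
      using combinatorially_equivalent_card_vertices[OF polytope polytope that[unfolded k(1) l(1)]]
      unfolding inv[OF k(2)] inv[OF l(2)] .
    then show "\<not> combinatorially_equivalent Q R"
      using QR k(1) l(1) by auto
  qed
  ultimately show ?thesis
    using polytope dim pos by (intro exI[of _ "(\<lambda>k. P (inv f k)) ` range f"]) auto
qed

end
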